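(* Let $x=(x_t(s,a))$ be an optimal occupation measure. If a policy $\pi$ is diffusion regular (with respect to $x$), then $V_N^* - V_N(\pi) = O(\sqrt{N})$ as $N\to\infty$.
   Context: Model. Fix, independently of $N$: a finite set $S$ (single-arm states), $A=\{0,1\}$ ($1$ = pull, $0$ = idle), a horizon $T$, $[T]=\{1,\dots,T\}$, transition kernels $p_t(s,a,s')$, rewards $r_t:S\times A\to\mathbb{R}$, rational budget ratios $\alpha_t\in[0,1]$, and an initial state $s^*\in S$. $N$ ranges over positive integers for which $\alpha_t N$ is an integer for all $t\in[T]$. There are $N$ arms, all in state $s^*$ at time $1$. At each time $t\in[T]$ every arm $i$ with state $s_{t,i}$ receives an action $a_{t,i}\in A$ chosen based on the current states and $t$; then, conditionally independently across arms, arm $i$ moves to state $s'$ with probability $p_t(s_{t,i},a_{t,i},s')$. The total reward at time $t$ is $R_t=\sum_{i=1}^N r_t(s_{t,i},a_{t,i})$. The budget constraint requires that exactly $\alpha_tN$ arms are pulled at each time $t$. Let $Z^N_t(s)$ be the number of arms in state $s$ at time $t$ and $X^N_t(s,a)$ the number of arms in state $s$ to which action $a$ is applied at time $t$. A policy $\pi$ is identified with maps (for each $N$ and $t$) $Z^N_t\mapsto X^N_t=\pi(t,Z^N_t)$ with $\sum_{a}X^N_t(s,a)=Z^N_t(s)$ and $\sum_s X^N_t(s,1)=\alpha_tN$. Its value is $V_N(\pi)=\mathbb{E}_\pi\sum_{t=1}^T R_t$, and $V_N^*=\sup_\pi V_N(\pi)$ over policies satisfying the budget constraint. Optimal occupation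 measure. A solution $x=(x_t(s,a))_{t\in[T],s\in S,a\in A}$ of the linear program: maximize $\sum_{t=1}^T\sum_{s,a} r_t(s,a)x_t(s,a)$ subject to $\sum_a x_t(s,a)=\sum_{a}\sum_{s'} x_{t-1}(s',a)p_{t-1}(s',a,s)$ for all $s\in S$, $2\le t\le T$; $\sum_s x_t(s,1)=\alpha_t$ for $t\in[T]$; $\sum_a x_1(s^*,a)=1$; $\sum_{s,a}x_1(s,a)=1$; $x_t(s,a)\ge 0$. Write $x_t=(x_t(s,a))_{s,a}$, $z_t(s)=\sum_a x_t(s,a)$, $z_t=(z_t(s))_s$. Diffusion regularity. Fix an optimal occupation measure $x$. The diffusion statistics are $\tilde Z^N_t=(Z^N_t-Nz_t)/\sqrt N$ and $\tilde X^N_t=(X^N_t-Nx_t)/\sqrt N$. A policy induces maps $\tilde\pi_{t,N}$ by $\pi(t,Z^N_t)=X^N_t\iff\tilde\pi_{t,N}(\tilde Z^N_t)=\tilde X^N_t$, i.e. $\tilde\pi_{t,N}(\theta)=(\pi(t,Nz_t+\sqrt N\theta)-Nx_t)/\sqrt N$; here the rule $\pi(t,\cdot)$ is regarded as defined on all real vectors $Z\in\mathbb{R}_{\ge0}^S$ with $\sum_sZ(s)=N$ (giving integer counts on integer vectors), and $\tilde\pi_{t,N}(\theta)$ is defined for those $\theta\in\mathbb{R}^S$ with $Nz_t+\sqrt N\theta$ in that set. With $|\cdot|$ the $L^1$-norm, $\pi$ is diffusion regular if: (1) there is $C_1>0$ with $|\tilde\pi_{t,N}(\theta_1)-\tilde\pi_{t,N}(\theta_2)|\le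 C_1|\theta_1-\theta_2|$ for all $t,N,\theta_1,\theta_2$; (2) there is $C_2>0$ with $|\tilde\pi_{t,N}(0)|\le C_2$ for all $t,N$; (3) there is a map $\tilde\pi_{t,\infty}$ such that $\tilde\pi_{t,N}(\theta)\to\tilde\pi_{t,\infty}(\theta)$ as $N\to\infty$ for all $\theta$ (for which $\tilde\pi_{t,N}(\theta)$ is defined for all large $N$). *)

theory Defs
  imports "HOL-Probability.Probability" "HOL-Probability.Product_PMF" "HOL-Library.Landau_Symbols"
begin

text \<open>
  Finite-horizon restless bandits with identical arms. Times are \<open>1, \<dots>, horizon M\<close>, and the
  action \<open>True\<close> means ``pull'', \<open>False\<close> means ``idle''.
\<close>

record 's bandit =
  horizon :: nat
  kernel :: "nat \<Rightarrow> 's \<Rightarrow> bool \<Rightarrow> 's pmf"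
  reward :: "nat \<Rightarrow> 's \<Rightarrow> bool \<Rightarrow> real"
  budget :: "nat \<Rightarrow> real"
  init :: 's

definition bandit :: "'s bandit \<Rightarrow> bool" where
  "bandit M \<longleftrightarrow> (\<forall>t\<in>{1..horizon M}. budget M t \<in> \<rat> \<and> 0 \<le> budget M t \<and> budget M t \<le> 1)"

definition sizes :: "'s bandit \<Rightarrow> nat set" where
  "sizes M = {N. 0 < N \<and> (\<forall>t\<in>{1..horizon M}. budget M t * real N \<in> \<int>)}"

text \<open>The filter of admissible numbers of arms tending to infinity.\<close>

definition large_sizes :: "'s bandit \<Rightarrow> nat filter" where
  "large_sizes M = inf at_top (principal (sizes M))"

text \<open>
  A rule (for a fixed number of arms) maps a time and a vector of numbers of arms per state to the
  numbers of arms per state and action. It is a function on real vectors, because diffusion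
  regularity evaluates it at non-integer points; the policy constraints concern count vectors.
\<close>

type_synonym 's rule = "nat \<Rightarrow> ('s \<Rightarrow> real) \<Rightarrow> 's \<Rightarrow> bool \<Rightarrow> real"

definition policy :: "('s::finite) bandit \<Rightarrow> nat \<Rightarrow> 's rule \<Rightarrow> bool" where
  "policy M N \<pi> \<longleftrightarrow>
     (\<forall>t\<in>{1..horizon M}. \<forall>Z :: 's \<Rightarrow> nat. (\<Sum>s\<in>UNIV. Z s) = N \<longrightarrow>
        (let X = \<pi> t (\<lambda>s. real (Z s)) in
           (\<forall>s a. X s a \<in> \<nat>) \<and>
           (\<forall>s. (\<Sum>a\<in>UNIV. X s a) = real (Z s)) \<and>
           (\<Sum>s\<in>UNIV. X s True) = budget M t * real N))"

text \<open>
  The arms are \<open>0, \<dots>, N - 1\<close>, and a configuration assigns a state to each of them (arguments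
  beyond \<open>N - 1\<close> are irrelevant).
\<close>

definition state_count :: "nat \<Rightarrow> (nat \<Rightarrow> 's) \<Rightarrow> 's \<Rightarrow> real" where
  "state_count N \<sigma> s = real (card {i. i < N \<and> \<sigma> i = s})"

text \<open>
  A rule prescribes only how many arms are pulled in each state. Which of them are pulled does not
  affect the law of the counts, hence not the value either; we pull those with the smallest indices.
\<close>

definition arm_action :: "nat \<Rightarrow> 's rule \<Rightarrow> nat \<Rightarrow> (nat \<Rightarrow> 's) \<Rightarrow> nat \<Rightarrow> bool" where
  "arm_action N \<pi> t \<sigma> i \<longleftrightarrow>
     real (card {j. j < i \<and> \<sigma> j = \<sigma> i}) < \<pi> t (state_count N \<sigma>) (\<sigma> i) True"

definition total_reward :: "'s bandit \<Rightarrow> nat \<Rightarrow> 's rule \<Rightarrow> nat \<Rightarrow> (nat \<Rightarrow> 's) \<Rightarrow> real" where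
  "total_reward M N \<pi> t \<sigma> = (\<Sum>i<N. reward M t (\<sigma> i) (arm_action N \<pi> t \<sigma> i))"

definition transition :: "'s bandit \<Rightarrow> nat \<Rightarrow> 's rule \<Rightarrow> nat \<Rightarrow> (nat \<Rightarrow> 's) \<Rightarrow> (nat \<Rightarrow> 's) pmf" where
  "transition M N \<pi> t \<sigma> =
     Pi_pmf {..<N} (init M) (\<lambda>i. kernel M t (\<sigma> i) (arm_action N \<pi> t \<sigma> i))"

text \<open>
  \<open>trajectory M N \<pi> n\<close> is the joint law of the configurations at times \<open>1, \<dots>, n + 1\<close>, that is,
  after \<open>n\<close> transitions; \<open>\<omega> t\<close> is the configuration at time \<open>t\<close>.
\<close>

primrec trajectory :: "'s bandit \<Rightarrow> nat \<Rightarrow> 's rule \<Rightarrow> nat \<Rightarrow> (nat \<Rightarrow> nat \<Rightarrow> 's) pmf" where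
  "trajectory M N \<pi> 0 = return_pmf (\<lambda>t i. init M)"
| "trajectory M N \<pi> (Suc n) =
     bind_pmf (trajectory M N \<pi> n)
       (\<lambda>\<omega>. map_pmf (\<lambda>\<sigma>. fun_upd \<omega> (Suc (Suc n)) \<sigma>) (transition M N \<pi> (Suc n) (\<omega> (Suc n))))"

definition policy_value :: "'s bandit \<Rightarrow> nat \<Rightarrow> 's rule \<Rightarrow> real" where
  "policy_value M N \<pi> =
     measure_pmf.expectation (trajectory M N \<pi> (horizon M))
       (\<lambda>\<omega>. \<Sum>t=1..horizon M. total_reward M N \<pi> t (\<omega> t))"

definition optimal_value :: "('s::finite) bandit \<Rightarrow> nat \<Rightarrow> real" where
  "optimal_value M N = (SUP \<pi>\<in>{\<pi>. policy M N \<pi>}. policy_value M N \<pi>)"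

definition lp_feasible :: "('s::finite) bandit \<Rightarrow> (nat \<Rightarrow> 's \<Rightarrow> bool \<Rightarrow> real) \<Rightarrow> bool" where
  "lp_feasible M x \<longleftrightarrow>
     (\<forall>t\<in>{2..horizon M}. \<forall>s. (\<Sum>a\<in>UNIV. x t s a) =
        (\<Sum>a\<in>UNIV. \<Sum>s'\<in>UNIV. x (t - 1) s' a * pmf (kernel M (t - 1) s' a) s)) \<and>
     (\<forall>t\<in>{1..horizon M}. (\<Sum>s\<in>UNIV. x t s True) = budget M t) \<and>
     (\<Sum>a\<in>UNIV. x 1 (init M) a) = 1 \<and>
     (\<Sum>s\<in>UNIV. \<Sum>a\<in>UNIV. x 1 s a) = 1 \<and>
     (\<forall>t\<in>{1..horizon M}. \<forall>s a. 0 \<le> x t s a)"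

definition lp_objective :: "('s::finite) bandit \<Rightarrow> (nat \<Rightarrow> 's \<Rightarrow> bool \<Rightarrow> real) \<Rightarrow> real" where
  "lp_objective M x = (\<Sum>t=1..horizon M. \<Sum>s\<in>UNIV. \<Sum>a\<in>UNIV. reward M t s a * x t s a)"

definition optimal_occupation_measure ::
    "('s::finite) bandit \<Rightarrow> (nat \<Rightarrow> 's \<Rightarrow> bool \<Rightarrow> real) \<Rightarrow> bool" where
  "optimal_occupation_measure M x \<longleftrightarrow> is_arg_max (lp_objective M) (lp_feasible M) x"

definition unscale ::
    "(nat \<Rightarrow> 's \<Rightarrow> bool \<Rightarrow> real) \<Rightarrow> nat \<Rightarrow> nat \<Rightarrow> ('s \<Rightarrow> real) \<Rightarrow> 's \<Rightarrow> real" where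
  "unscale x N t \<theta> s = real N * (\<Sum>a\<in>UNIV. x t s a) + sqrt (real N) * \<theta> s"

definition diffusion_domain ::
    "(nat \<Rightarrow> ('s::finite) \<Rightarrow> bool \<Rightarrow> real) \<Rightarrow> nat \<Rightarrow> nat \<Rightarrow> ('s \<Rightarrow> real) set" where
  "diffusion_domain x N t =
     {\<theta>. (\<forall>s. 0 \<le> unscale x N t \<theta> s) \<and> (\<Sum>s\<in>UNIV. unscale x N t \<theta> s) = real N}"

definition diffusion_map ::
    "(nat \<Rightarrow> 's \<Rightarrow> bool \<Rightarrow> real) \<Rightarrow> (nat \<Rightarrow> 's rule) \<Rightarrow> nat \<Rightarrow> nat \<Rightarrow> ('s \<Rightarrow> real) \<Rightarrow> 's \<Rightarrow> bool \<Rightarrow> real" where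
  "diffusion_map x \<pi> N t \<theta> s a = (\<pi> N t (unscale x N t \<theta>) s a - real N * x t s a) / sqrt (real N)"

definition diffusion_regular ::
    "('s::finite) bandit \<Rightarrow> (nat \<Rightarrow> 's \<Rightarrow> bool \<Rightarrow> real) \<Rightarrow> (nat \<Rightarrow> 's rule) \<Rightarrow> bool" where
  "diffusion_regular M x \<pi> \<longleftrightarrow>
     (\<exists>C\<^sub>1>0. \<forall>t\<in>{1..horizon M}. \<forall>N\<in>sizes M.
        \<forall>\<theta>\<^sub>1\<in>diffusion_domain x N t. \<forall>\<theta>\<^sub>2\<in>diffusion_domain x N t.
          (\<Sum>s\<in>UNIV. \<Sum>a\<in>UNIV. \<bar>diffusion_map x \<pi> N t \<theta>\<^sub>1 s a - diffusion_map x \<pi> N t \<theta>\<^sub>2 s a\<bar>)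
            \<le> C\<^sub>1 * (\<Sum>s\<in>UNIV. \<bar>\<theta>\<^sub>1 s - \<theta>\<^sub>2 s\<bar>)) \<and>
     (\<exists>C\<^sub>2>0. \<forall>t\<in>{1..horizon M}. \<forall>N\<in>sizes M.
        (\<Sum>s\<in>UNIV. \<Sum>a\<in>UNIV. \<bar>diffusion_map x \<pi> N t (\<lambda>_. 0) s a\<bar>) \<le> C\<^sub>2) \<and>
     (\<exists>\<rho> :: nat \<Rightarrow> ('s \<Rightarrow> real) \<Rightarrow> 's \<Rightarrow> bool \<Rightarrow> real. \<forall>t\<in>{1..horizon M}. \<forall>\<theta>.
        (\<forall>\<^sub>F N in large_sizes M. \<theta> \<in> diffusion_domain x N t) \<longrightarrow>
        (\<forall>s a. ((\<lambda>N. diffusion_map x \<pi> N t \<theta> s a) \<longlongrightarrow> \<rho> t \<theta> s a) (large_sizes M)))"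

end

theory Submission
  imports Defs
begin

text \<open>
  The gap is squeezed between \<open>N\<close> times the value of the linear program and the value of the given
  policy.

  Upper bound (\<open>policy_value_le_lp\<close>). Both the rewards and the conditional expectation of the next
  state counts are linear in the action counts \<open>X\<^sub>t(s, a)\<close>. Hence, for every admissible policy, the
  expected action counts divided by \<open>N\<close> satisfy all constraints of the linear program, and their
  objective value is the policy value divided by \<open>N\<close>. The linear program thus relaxes the
  stochastic control problem, and no policy is worth more than \<open>N\<close> times its optimum.

  Lower bound (\<open>policy_value_ge_lp\<close>). Given the configuration at time \<open>t\<close>, the arms move
  independently, so each state count at time \<open>t + 1\<close> has variance at most \<open>N\<close> and differs from its
  conditional mean by at most \<open>\<surd>N\<close> in expectation (\<open>next_count_deviation\<close>). The flow constraint says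
  that \<open>N x\<^sub>t\<close> is carried to \<open>N z\<^sub>t\<^sub>+\<^sub>1\<close> by the same linear map that carries \<open>X\<^sub>t\<close> to this
  conditional mean, and that map is an \<open>L\<^sup>1\<close> contraction. Diffusion regularity, undone from the
  diffusive scale, reads \<open>|X\<^sub>t - N x\<^sub>t| \<le> C\<^sub>1 |Z\<^sub>t - N z\<^sub>t| + C\<^sub>2 \<surd>N\<close>. By induction on time
  (\<open>expectation_count_deviation_le\<close>) the expected deviation from \<open>N z\<^sub>t\<close> stays \<open>O(\<surd>N)\<close>: it starts at
  \<open>0\<close> and is multiplied by a constant and increased by \<open>O(\<surd>N)\<close> in each of the finitely many steps.
  The action counts, and by linearity the value, then also differ from those of \<open>N x\<close> by \<open>O(\<surd>N)\<close>.

  Since states are finite in number, every law that occurs has finite support, which settles all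
  questions of integrability.
\<close>

section \<open>Expectations over finitely supported distributions\<close>

lemma expectation_bind_pmf_finite:
  fixes h :: "'b \<Rightarrow> real"
  assumes "finite (set_pmf p)" "\<And>x. x \<in> set_pmf p \<Longrightarrow> finite (set_pmf (f x))"
  shows "measure_pmf.expectation (bind_pmf p f) h =
    measure_pmf.expectation p (\<lambda>x. measure_pmf.expectation (f x) h)"
  using assms
  by (subst pmf_expectation_bind[of "set_pmf p"])
     (auto simp: integral_measure_pmf_real[where A = "set_pmf p"] mult.commute)

lemma expectation_pair_pmf_finite:
  fixes h :: "'a \<Rightarrow> 'b \<Rightarrow> real"
  assumes "finite (set_pmf p)" "finite (set_pmf q)"
  shows "measure_pmf.expectation (pair_pmf p q) (\<lambda>(x, y). h x y) =
    measure_pmf.expectation p (\<lambda>x. measure_pmf.expectation q (h x))"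
proof -
  have "measure_pmf.expectation (pair_pmf p q) (\<lambda>(x, y). h x y) =
      measure_pmf.expectation p (\<lambda>x. measure_pmf.expectation (bind_pmf q (\<lambda>y. return_pmf (x, y))) (\<lambda>(x, y). h x y))"
    unfolding pair_pmf_def using assms by (subst expectation_bind_pmf_finite) auto
  also have "\<dots> = measure_pmf.expectation p (\<lambda>x. measure_pmf.expectation q (h x))"
    using assms by (subst expectation_bind_pmf_finite) auto
  finally show ?thesis .
qed

lemma finite_set_Pi_pmf:
  assumes "finite A" "\<And>i. i \<in> A \<Longrightarrow> finite (set_pmf (p i))"
  shows "finite (set_pmf (Pi_pmf A d p))"
  using assms by (subst set_Pi_pmf) (auto intro!: finite_PiE_dflt)

text \<open>
  Variances of independent variables add up. The first moment is carried along because adding one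
  more coordinate produces a cross term, and this vanishes as the partial sum is centred.
\<close>

lemma second_moment_sum_Pi_pmf:
  fixes g :: "'i \<Rightarrow> 'b \<Rightarrow> real"
  assumes "finite A"
    and fin: "\<And>i. i \<in> A \<Longrightarrow> finite (set_pmf (p i))"
    and centred: "\<And>i. i \<in> A \<Longrightarrow> measure_pmf.expectation (p i) (g i) = 0"
    and bounded: "\<And>i y. i \<in> A \<Longrightarrow> \<bar>g i y\<bar> \<le> 1"
  shows "measure_pmf.expectation (Pi_pmf A d p) (\<lambda>\<sigma>. \<Sum>i\<in>A. g i (\<sigma> i)) = 0 \<and>
    measure_pmf.expectation (Pi_pmf A d p) (\<lambda>\<sigma>. (\<Sum>i\<in>A. g i (\<sigma> i))\<^sup>2) \<le> real (card A)"
  using assms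
proof (induction A rule: finite_induct)
  case empty
  then show ?case by simp
next
  case (insert k A)
  let ?Q = "Pi_pmf A d p"
  let ?S = "\<lambda>\<sigma>. \<Sum>i\<in>A. g i (\<sigma> i)"
  have finQ: "finite (set_pmf ?Q)" and fink: "finite (set_pmf (p k))"
    using insert by (auto intro: finite_set_Pi_pmf)
  have intQ [simp]: "integrable ?Q f" for f :: "_ \<Rightarrow> real"
    by (rule integrable_measure_pmf_finite[OF finQ])
  have intk [simp]: "integrable (p k) f" for f :: "_ \<Rightarrow> real"
    by (rule integrable_measure_pmf_finite[OF fink])
  have IH: "measure_pmf.expectation ?Q ?S = 0"
    "measure_pmf.expectation ?Q (\<lambda>\<sigma>. (?S \<sigma>)\<^sup>2) \<le> real (card A)"
    using insert by auto
  have ck: "measure_pmf.expectation (p k) (g k) = 0" using insert by auto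
  have sum_eq: "(\<Sum>i\<in>insert k A. g i ((\<sigma>(k := y)) i)) = g k y + ?S \<sigma>" for y \<sigma>
  proof -
    have "(\<Sum>i\<in>A. g i ((\<sigma>(k := y)) i)) = ?S \<sigma>"
      using insert by (intro sum.cong) auto
    then show ?thesis using insert by simp
  qed
  have E: "measure_pmf.expectation (Pi_pmf (insert k A) d p) (\<lambda>\<sigma>. F (\<Sum>i\<in>insert k A. g i (\<sigma> i))) =
      measure_pmf.expectation (p k) (\<lambda>y. measure_pmf.expectation ?Q (\<lambda>\<sigma>. F (g k y + ?S \<sigma>)))"
    for F :: "real \<Rightarrow> real"
  proof -
    have "measure_pmf.expectation (Pi_pmf (insert k A) d p) (\<lambda>\<sigma>. F (\<Sum>i\<in>insert k A. g i (\<sigma> i))) =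
        measure_pmf.expectation (pair_pmf (p k) ?Q)
          (\<lambda>(y, \<sigma>). F (\<Sum>i\<in>insert k A. g i ((\<sigma>(k := y)) i)))"
      using insert by (subst Pi_pmf_insert) (auto simp: case_prod_unfold)
    also have "\<dots> = measure_pmf.expectation (p k) (\<lambda>y. measure_pmf.expectation ?Q (\<lambda>\<sigma>. F (g k y + ?S \<sigma>)))"
      unfolding sum_eq by (rule expectation_pair_pmf_finite[OF fink finQ])
    finally show ?thesis .
  qed
  have 1: "measure_pmf.expectation (Pi_pmf (insert k A) d p) (\<lambda>\<sigma>. \<Sum>i\<in>insert k A. g i (\<sigma> i)) = 0"
    using E[of "\<lambda>u. u"] IH ck by simp
  \<comment> \<open>the cross term \<open>2 g\<^sub>k(y) E S\<close> vanishes\<close>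
  have sq: "measure_pmf.expectation ?Q (\<lambda>\<sigma>. (g k y + ?S \<sigma>)\<^sup>2) =
      (g k y)\<^sup>2 + measure_pmf.expectation ?Q (\<lambda>\<sigma>. (?S \<sigma>)\<^sup>2)" for y
    using IH by (simp add: power2_sum mult.assoc)
  have "measure_pmf.expectation (p k) (\<lambda>y. (g k y)\<^sup>2) \<le> measure_pmf.expectation (p k) (\<lambda>y. 1)"
    using insert.prems(3)[of k] by (intro integral_mono) (auto simp: abs_square_le_1)
  then have 2: "measure_pmf.expectation (Pi_pmf (insert k A) d p) (\<lambda>\<sigma>. (\<Sum>i\<in>insert k A. g i (\<sigma> i))\<^sup>2)
      \<le> real (card (insert k A))"
    using E[of "\<lambda>u. u\<^sup>2"] IH(2) insert.hyps by (simp add: sq)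
  show ?case using 1 2 by blast
qed

text \<open>
  This weak form of the Cauchy-Schwarz inequality comes from integrating the pointwise bound
  \<open>|u| \<le> (r + u\<^sup>2 / r) / 2\<close> at \<open>r = \<surd>N\<close>.
\<close>

lemma first_moment_le_sqrt:
  fixes f :: "'b \<Rightarrow> real"
  assumes fin: "finite (set_pmf p)" and "0 < N"
    and "measure_pmf.expectation p (\<lambda>y. (f y)\<^sup>2) \<le> real N"
  shows "measure_pmf.expectation p (\<lambda>y. \<bar>f y\<bar>) \<le> sqrt (real N)"
proof -
  have [simp]: "integrable p f" for f :: "_ \<Rightarrow> real"
    by (rule integrable_measure_pmf_finite[OF fin])
  define r where "r = sqrt (real N)"
  have r: "r > 0" "r * r = real N" using assms by (auto simp: r_def)
  have "\<bar>u\<bar> \<le> (r + u\<^sup>2 / r) / 2" for u :: real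
  proof -
    have "0 \<le> (\<bar>u\<bar> - r)\<^sup>2" by simp
    then have "2 * \<bar>u\<bar> * r \<le> r * r + u\<^sup>2" by (simp add: power2_eq_square algebra_simps)
    then show ?thesis using r by (simp add: field_simps)
  qed
  then have "measure_pmf.expectation p (\<lambda>y. \<bar>f y\<bar>) \<le> measure_pmf.expectation p (\<lambda>y. (r + (f y)\<^sup>2 / r) / 2)"
    by (intro integral_mono) auto
  also have "\<dots> = (r + measure_pmf.expectation p (\<lambda>y. (f y)\<^sup>2) / r) / 2" by simp
  also have "\<dots> \<le> (r + real N / r) / 2"
    using assms r by (intro divide_right_mono add_left_mono) auto
  also have "\<dots> = r" using r(1) by (simp flip: r(2))
  finally show ?thesis by (simp add: r_def)
qed

section \<open>Counting arms\<close>

text \<open>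
  Here \<open>card {j \<in> B. j < i}\<close> is the rank of \<open>i\<close> in \<open>B\<close>, and the ranks are \<open>0, \<dots>, card B - 1\<close>. A rule
  pulls the arms of small rank among those in the same state, so this lemma counts the pulled arms.
  In the induction a new maximum leaves the other ranks unchanged and itself gets rank \<open>card A\<close>.
\<close>

lemma card_rank_less:
  fixes B :: "nat set"
  assumes "finite B"
  shows "card {i \<in> B. card {j \<in> B. j < i} < k} = min k (card B)"
  using assms
proof (induction B rule: finite_linorder_max_induct)
  case empty
  then show ?case by simp
next
  case (insert b A)
  have b: "b \<notin> A" using insert.hyps by auto
  define P where "P i \<longleftrightarrow> card {j \<in> A. j < i} < k" for i
  define Q where "Q i \<longleftrightarrow> card {j \<in> insert b A. j < i} < k" for i
  have below: "Q i = P i" if "i \<in> A" for i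
  proof -
    have "{j \<in> insert b A. j < i} = {j \<in> A. j < i}" using insert.hyps that by auto
    then show ?thesis by (simp only: P_def Q_def)
  qed
  have top: "Q b \<longleftrightarrow> card A < k"
  proof -
    have "{j \<in> insert b A. j < b} = A" using insert.hyps by auto
    then show ?thesis by (simp only: Q_def)
  qed
  have "{i \<in> insert b A. Q i} = {i \<in> A. P i} \<union> (if card A < k then {b} else {})"
    using below top by auto
  also have "card \<dots> = card {i \<in> A. P i} + (if card A < k then 1 else 0)"
    using insert.hyps b by (subst card_Un_disjoint) auto
  also have "card {i \<in> A. P i} = min k (card A)"
    unfolding P_def by (rule insert.IH)
  also have "min k (card A) + (if card A < k then 1 else 0) = min k (card (insert b A))"
    using card_insert_disjoint[OF insert.hyps(1) b] by simp
  finally show ?case unfolding Q_def .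
qed

lemma sum_of_bool_lessThan: "(\<Sum>i<N. of_bool (P i) :: real) = real (card {i. i < N \<and> P i})"
  for N :: nat
proof -
  have "{..<N} \<inter> {i. P i} = {i. i < N \<and> P i}" by auto
  then show ?thesis by simp
qed

lemma state_count_eq_sum: "state_count N \<sigma> s = (\<Sum>i<N. of_bool (\<sigma> i = s))"
  unfolding state_count_def sum_of_bool_lessThan ..

lemma sum_state_count: "(\<Sum>s\<in>UNIV. state_count N \<sigma> s) = real N" for \<sigma> :: "nat \<Rightarrow> 's::finite"
  unfolding state_count_eq_sum by (subst sum.swap) (simp add: of_bool_def)

lemma state_count_nonneg: "0 \<le> state_count N \<sigma> s"
  by (simp add: state_count_def)

lemma policy_state_count:
  fixes M :: "('s::finite) bandit"
  assumes "policy M N \<pi>" "t \<in> {1..horizon M}"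
  shows "\<pi> t (state_count N \<sigma>) s a \<in> \<nat>"
    and "(\<Sum>a\<in>UNIV. \<pi> t (state_count N \<sigma>) s a) = state_count N \<sigma> s"
    and "(\<Sum>s\<in>UNIV. \<pi> t (state_count N \<sigma>) s True) = budget M t * real N"
proof -
  define Z where "Z s = card {i. i < N \<and> \<sigma> i = s}" for s
  have Z: "state_count N \<sigma> = (\<lambda>s. real (Z s))" by (auto simp: state_count_def Z_def)
  have "real (\<Sum>s\<in>UNIV. Z s) = real N"
    using sum_state_count[of N \<sigma>] by (simp add: Z)
  then have "(\<Sum>s\<in>UNIV. Z s) = N" by linarith
  then show "\<pi> t (state_count N \<sigma>) s a \<in> \<nat>"
    and "(\<Sum>a\<in>UNIV. \<pi> t (state_count N \<sigma>) s a) = state_count N \<sigma> s"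
    and "(\<Sum>s\<in>UNIV. \<pi> t (state_count N \<sigma>) s True) = budget M t * real N"
    using assms unfolding policy_def Let_def Z by blast+
qed

text \<open>
  The concrete choice of the pulled arms realises the counts that the rule prescribes, also for the
  idle arms: those are the remaining ones, and the prescribed numbers add up to the number of arms in
  the state.
\<close>

lemma card_arms_with_action:
  fixes M :: "('s::finite) bandit"
  assumes "policy M N \<pi>" "t \<in> {1..horizon M}"
  shows "real (card {i. i < N \<and> \<sigma> i = s \<and> arm_action N \<pi> t \<sigma> i = a}) = \<pi> t (state_count N \<sigma>) s a"
proof -
  let ?B = "{i. i < N \<and> \<sigma> i = s}"
  let ?A = "{i. i < N \<and> \<sigma> i = s \<and> arm_action N \<pi> t \<sigma> i}"
  let ?X = "\<pi> t (state_count N \<sigma>) s"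
  note P = policy_state_count[OF assms, of \<sigma>]
  obtain k where k: "?X True = real k" using P(1)[of s True] by (auto elim: Nats_cases)
  have split: "?X False + ?X True = real (card ?B)"
    using P(2)[of s] by (simp add: UNIV_bool state_count_def)
  have "0 \<le> ?X False" using P(1)[of s False] by (auto elim: Nats_cases)
  then have kle: "k \<le> card ?B" using split k by simp
  have "arm_action N \<pi> t \<sigma> i \<longleftrightarrow> card {j \<in> ?B. j < i} < k" if "i < N" "\<sigma> i = s" for i
  proof -
    have "{j. j < i \<and> \<sigma> j = \<sigma> i} = {j \<in> ?B. j < i}" using that by auto
    then show ?thesis by (simp add: arm_action_def that(2) k)
  qed
  then have "?A = {i \<in> ?B. card {j \<in> ?B. j < i} < k}"
    by auto
  then have T: "card ?A = k"
    using kle card_rank_less[of ?B k] by simp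
  have eq: "{i. i < N \<and> \<sigma> i = s \<and> \<not> arm_action N \<pi> t \<sigma> i} = ?B - ?A"
    by auto
  have "card (?B - ?A) = card ?B - card ?A"
    by (rule card_Diff_subset) auto
  then have F: "card {i. i < N \<and> \<sigma> i = s \<and> \<not> arm_action N \<pi> t \<sigma> i} = card ?B - k"
    by (simp only: eq T)
  show ?thesis
  proof (cases a)
    case True
    have "?X True = real (card ?A)"
      by (simp only: T k)
    then show ?thesis using True by simp
  next
    case False
    have "?X False = real (card ?B - k)"
      using split k kle by linarith
    then have "?X False = real (card {i. i < N \<and> \<sigma> i = s \<and> \<not> arm_action N \<pi> t \<sigma> i})"
      by (simp only: F)
    then show ?thesis using False by simp
  qed
qed

text \<open>
  With \<open>f\<close> the reward or a transition probability, this shows that the choice of the pulled arms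
  matters only through the action counts.
\<close>

lemma sum_over_arms:
  fixes M :: "('s::finite) bandit" and f :: "'s \<Rightarrow> bool \<Rightarrow> real"
  assumes "policy M N \<pi>" "t \<in> {1..horizon M}"
  shows "(\<Sum>i<N. f (\<sigma> i) (arm_action N \<pi> t \<sigma> i)) =
    (\<Sum>s\<in>UNIV. \<Sum>a\<in>UNIV. f s a * \<pi> t (state_count N \<sigma>) s a)"
proof -
  have count: "(\<Sum>i<N. of_bool (\<sigma> i = s \<and> arm_action N \<pi> t \<sigma> i = a)) = \<pi> t (state_count N \<sigma>) s a" for s a
    unfolding sum_of_bool_lessThan by (rule card_arms_with_action[OF assms])
  have "f (\<sigma> i) (arm_action N \<pi> t \<sigma> i) =
      (\<Sum>s\<in>UNIV. \<Sum>a\<in>UNIV. f s a * of_bool (\<sigma> i = s \<and> arm_action N \<pi> t \<sigma> i = a))" for i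
  proof -
    have "(\<Sum>a\<in>UNIV. f s a * of_bool (\<sigma> i = s \<and> arm_action N \<pi> t \<sigma> i = a)) =
        (if \<sigma> i = s then f s (arm_action N \<pi> t \<sigma> i) else 0)" for s
      by (auto simp: UNIV_bool)
    then show ?thesis by simp
  qed
  then have "(\<Sum>i<N. f (\<sigma> i) (arm_action N \<pi> t \<sigma> i)) =
      (\<Sum>i<N. \<Sum>s\<in>UNIV. \<Sum>a\<in>UNIV. f s a * of_bool (\<sigma> i = s \<and> arm_action N \<pi> t \<sigma> i = a))"
    by simp
  also have "\<dots> = (\<Sum>s\<in>UNIV. \<Sum>a\<in>UNIV. \<Sum>i<N. f s a * of_bool (\<sigma> i = s \<and> arm_action N \<pi> t \<sigma> i = a))"
    by (subst sum.swap) (intro sum.cong refl sum.swap)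
  also have "\<dots> = (\<Sum>s\<in>UNIV. \<Sum>a\<in>UNIV. f s a * \<pi> t (state_count N \<sigma>) s a)"
    by (simp only: sum_distrib_left[symmetric] count)
  finally show ?thesis .
qed

section \<open>One transition\<close>

text \<open>
  The linear map that turns action counts at time \<open>t\<close> into expected state counts at time \<open>t + 1\<close>.
  The same map occurs in the flow constraint of the linear program.
\<close>

definition mean_next_count ::
    "('s::finite) bandit \<Rightarrow> nat \<Rightarrow> ('s \<Rightarrow> bool \<Rightarrow> real) \<Rightarrow> 's \<Rightarrow> real" where
  "mean_next_count M t X s = (\<Sum>a\<in>UNIV. \<Sum>s'\<in>UNIV. X s' a * pmf (kernel M t s' a) s)"

lemma sum_mean_next_count:
  fixes M :: "('s::finite) bandit"
  shows "(\<Sum>s\<in>UNIV. mean_next_count M t X s) = (\<Sum>s\<in>UNIV. \<Sum>a\<in>UNIV. X s a)"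
proof -
  have mass: "(\<Sum>s\<in>UNIV. pmf (kernel M t s' a) s) = 1" for s' a
    by (rule sum_pmf_eq_1) auto
  have "(\<Sum>s\<in>UNIV. mean_next_count M t X s) =
      (\<Sum>a\<in>UNIV. \<Sum>s'\<in>UNIV. \<Sum>s\<in>UNIV. X s' a * pmf (kernel M t s' a) s)"
    unfolding mean_next_count_def by (subst sum.swap) (intro sum.cong refl sum.swap)
  also have "\<dots> = (\<Sum>a\<in>UNIV. \<Sum>s'\<in>UNIV. X s' a)"
    by (simp add: sum_distrib_left[symmetric] mass)
  also have "\<dots> = (\<Sum>s\<in>UNIV. \<Sum>a\<in>UNIV. X s a)" by (rule sum.swap)
  finally show ?thesis .
qed

lemma abs_mean_next_count_diff_le:
  "\<bar>mean_next_count M t X s - mean_next_count M t Y s\<bar> \<le> mean_next_count M t (\<lambda>s a. \<bar>X s a - Y s a\<bar>) s"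
proof -
  have "mean_next_count M t X s - mean_next_count M t Y s = mean_next_count M t (\<lambda>s a. X s a - Y s a) s"
    by (simp add: mean_next_count_def sum_subtractf[symmetric] left_diff_distrib)
  then show ?thesis
    by (auto simp: mean_next_count_def abs_mult intro!: order_trans[OF sum_abs] sum_mono)
qed

lemma finite_set_transition: "finite (set_pmf (transition M N \<pi> t \<sigma>))" for M :: "('s::finite) bandit"
  unfolding transition_def by (rule finite_set_Pi_pmf) auto

lemma sum_pmf_kernel:
  fixes M :: "('s::finite) bandit"
  assumes "policy M N \<pi>" "t \<in> {1..horizon M}"
  shows "(\<Sum>i<N. pmf (kernel M t (\<sigma> i) (arm_action N \<pi> t \<sigma> i)) s) =
    mean_next_count M t (\<pi> t (state_count N \<sigma>)) s"
  unfolding mean_next_count_def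
  unfolding sum_over_arms[OF assms, of "\<lambda>s' a. pmf (kernel M t s' a) s" \<sigma>]
  by (subst sum.swap) (simp only: mult.commute)

lemma expectation_indicator_pmf: "measure_pmf.expectation p (\<lambda>y. of_bool (y = s)) = pmf p s"
proof -
  have "(\<lambda>y. of_bool (y = s)) = (indicator {s} :: _ \<Rightarrow> real)" by (auto simp: indicator_def)
  then show ?thesis by (simp add: measure_pmf_single)
qed

text \<open>
  A state count is a sum of one indicator per arm, and given the current configuration these
  indicators are independent. Both claims follow by centring them.
\<close>

lemma
  fixes M :: "('s::finite) bandit"
  assumes "policy M N \<pi>" "t \<in> {1..horizon M}" "0 < N"
  shows expectation_next_count:
      "measure_pmf.expectation (transition M N \<pi> t \<sigma>) (\<lambda>\<sigma>'. state_count N \<sigma>' s) =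
        mean_next_count M t (\<pi> t (state_count N \<sigma>)) s"
    and next_count_deviation:
      "measure_pmf.expectation (transition M N \<pi> t \<sigma>)
          (\<lambda>\<sigma>'. \<bar>state_count N \<sigma>' s - mean_next_count M t (\<pi> t (state_count N \<sigma>)) s\<bar>) \<le> sqrt (real N)"
proof -
  let ?q = "\<lambda>i. kernel M t (\<sigma> i) (arm_action N \<pi> t \<sigma> i)"
  let ?g = "\<lambda>i y. of_bool (y = s) - pmf (?q i) s"
  let ?m = "mean_next_count M t (\<pi> t (state_count N \<sigma>)) s"
  let ?P = "transition M N \<pi> t \<sigma>"
  have [simp]: "integrable p f" for p :: "'s pmf" and f :: "_ \<Rightarrow> real"
    by (rule integrable_measure_pmf_finite) simp
  have [simp]: "integrable ?P f" for f :: "_ \<Rightarrow> real"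
    by (rule integrable_measure_pmf_finite[OF finite_set_transition])
  have sum_g: "(\<Sum>i<N. ?g i (\<sigma>' i)) = state_count N \<sigma>' s - ?m" for \<sigma>'
    by (simp add: sum_subtractf state_count_eq_sum sum_pmf_kernel[OF assms(1,2)])
  have "measure_pmf.expectation (?q i) (?g i) = 0" for i
    by (simp add: expectation_indicator_pmf)
  moreover have "\<bar>?g i y\<bar> \<le> 1" for i y
    using pmf_le_1[of "?q i" s]
    by (cases "y = s") (auto simp: abs_le_iff intro: order_trans[OF _ pmf_nonneg])
  ultimately have "measure_pmf.expectation ?P (\<lambda>\<sigma>'. \<Sum>i<N. ?g i (\<sigma>' i)) = 0 \<and>
      measure_pmf.expectation ?P (\<lambda>\<sigma>'. (\<Sum>i<N. ?g i (\<sigma>' i))\<^sup>2) \<le> real (card {..<N})"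
    unfolding transition_def by (intro second_moment_sum_Pi_pmf) auto
  then have m: "measure_pmf.expectation ?P (\<lambda>\<sigma>'. state_count N \<sigma>' s - ?m) = 0"
    and v: "measure_pmf.expectation ?P (\<lambda>\<sigma>'. (state_count N \<sigma>' s - ?m)\<^sup>2) \<le> real N"
    unfolding sum_g by auto
  show "measure_pmf.expectation ?P (\<lambda>\<sigma>'. state_count N \<sigma>' s) = ?m" using m by simp
  show "measure_pmf.expectation ?P (\<lambda>\<sigma>'. \<bar>state_count N \<sigma>' s - ?m\<bar>) \<le> sqrt (real N)"
    by (rule first_moment_le_sqrt[OF finite_set_transition assms(3) v])
qed

section \<open>The law of the configuration at a given time\<close>

text \<open>
  The process is Markov in the configuration, so it suffices to follow the marginal laws.
  The index counts transitions: \<open>config_law M N \<pi> n\<close> belongs to time \<open>n + 1\<close>.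
\<close>

primrec config_law :: "'s bandit \<Rightarrow> nat \<Rightarrow> 's rule \<Rightarrow> nat \<Rightarrow> (nat \<Rightarrow> 's) pmf" where
  "config_law M N \<pi> 0 = return_pmf (\<lambda>i. init M)"
| "config_law M N \<pi> (Suc n) = bind_pmf (config_law M N \<pi> n) (transition M N \<pi> (Suc n))"

lemma finite_set_config_law: "finite (set_pmf (config_law M N \<pi> n))" for M :: "('s::finite) bandit"
  by (induction n) (auto intro: finite_set_transition)

lemma integrable_config_law [simp]: "integrable (config_law M N \<pi> n) f"
  for M :: "('s::finite) bandit" and f :: "_ \<Rightarrow> real"
  by (rule integrable_measure_pmf_finite[OF finite_set_config_law])

lemma finite_set_trajectory: "finite (set_pmf (trajectory M N \<pi> n))" for M :: "('s::finite) bandit"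
  by (induction n) (auto intro: finite_set_transition)

lemma map_trajectory: "m \<le> n \<Longrightarrow> map_pmf (\<lambda>\<omega>. \<omega> (Suc m)) (trajectory M N \<pi> n) = config_law M N \<pi> m"
proof (induction n arbitrary: m)
  case 0
  then show ?case by simp
next
  case (Suc n)
  show ?case
  proof (cases "m = Suc n")
    case True
    have "map_pmf (\<lambda>\<omega>. \<omega> (Suc m)) (trajectory M N \<pi> (Suc n)) =
        bind_pmf (trajectory M N \<pi> n) (\<lambda>\<omega>. transition M N \<pi> (Suc n) (\<omega> (Suc n)))"
      by (simp add: True map_bind_pmf map_pmf_comp)
    also have "\<dots> = bind_pmf (map_pmf (\<lambda>\<omega>. \<omega> (Suc n)) (trajectory M N \<pi> n)) (transition M N \<pi> (Suc n))"
      by (simp add: bind_map_pmf)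
    finally show ?thesis using True Suc.IH[of n] by simp
  next
    case False
    then have "map_pmf (\<lambda>\<omega>. \<omega> (Suc m)) (trajectory M N \<pi> (Suc n)) =
        bind_pmf (trajectory M N \<pi> n) (\<lambda>\<omega>. return_pmf (\<omega> (Suc m)))"
      using Suc.prems by (simp add: map_bind_pmf map_pmf_comp)
    then show ?thesis using Suc False by (simp add: map_pmf_def)
  qed
qed

definition mean_action ::
    "('s::finite) bandit \<Rightarrow> nat \<Rightarrow> 's rule \<Rightarrow> nat \<Rightarrow> 's \<Rightarrow> bool \<Rightarrow> real" where
  "mean_action M N \<pi> t s a =
     measure_pmf.expectation (config_law M N \<pi> (t - 1)) (\<lambda>\<sigma>. \<pi> t (state_count N \<sigma>) s a)"

text \<open>
  Since rewards are linear in the action counts, the value depends on the policy only through the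
  expected action counts and is given by the objective function of the linear program.
\<close>

lemma policy_value_eq_mean_action:
  fixes M :: "('s::finite) bandit"
  assumes "policy M N \<pi>"
  shows "policy_value M N \<pi> = lp_objective M (mean_action M N \<pi>)"
proof -
  have [simp]: "integrable (trajectory M N \<pi> n) f" for n and f :: "_ \<Rightarrow> real"
    by (rule integrable_measure_pmf_finite[OF finite_set_trajectory])
  have "policy_value M N \<pi> = (\<Sum>t=1..horizon M.
      measure_pmf.expectation (trajectory M N \<pi> (horizon M)) (\<lambda>\<omega>. total_reward M N \<pi> t (\<omega> t)))"
    unfolding policy_value_def by (subst Bochner_Integration.integral_sum) auto
  also have "\<dots> = lp_objective M (mean_action M N \<pi>)"
    unfolding lp_objective_def
  proof (rule sum.cong[OF refl])
    fix t assume t: "t \<in> {1..horizon M}"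
    then have t1: "Suc (t - 1) = t" by auto
    have "map_pmf (\<lambda>\<omega>. \<omega> t) (trajectory M N \<pi> (horizon M)) = config_law M N \<pi> (t - 1)"
      using t map_trajectory[of "t - 1" "horizon M" M N \<pi>] unfolding t1 by auto
    then have "measure_pmf.expectation (trajectory M N \<pi> (horizon M)) (\<lambda>\<omega>. total_reward M N \<pi> t (\<omega> t)) =
        measure_pmf.expectation (config_law M N \<pi> (t - 1)) (total_reward M N \<pi> t)"
      by (metis integral_map_pmf)
    also have "\<dots> = measure_pmf.expectation (config_law M N \<pi> (t - 1))
        (\<lambda>\<sigma>. \<Sum>s\<in>UNIV. \<Sum>a\<in>UNIV. reward M t s a * \<pi> t (state_count N \<sigma>) s a)"
      unfolding total_reward_def sum_over_arms[OF assms t] ..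
    also have "\<dots> = (\<Sum>s\<in>UNIV. \<Sum>a\<in>UNIV. reward M t s a * mean_action M N \<pi> t s a)"
      by (simp add: mean_action_def)
    finally show "measure_pmf.expectation (trajectory M N \<pi> (horizon M)) (\<lambda>\<omega>. total_reward M N \<pi> t (\<omega> t)) =
        (\<Sum>s\<in>UNIV. \<Sum>a\<in>UNIV. reward M t s a * mean_action M N \<pi> t s a)" .
  qed
  finally show ?thesis .
qed

section \<open>The linear program bounds every policy\<close>

lemma expectation_count_Suc:
  fixes M :: "('s::finite) bandit"
  assumes "policy M N \<pi>" "Suc n \<in> {1..horizon M}" "0 < N"
  shows "measure_pmf.expectation (config_law M N \<pi> (Suc n)) (\<lambda>\<sigma>. state_count N \<sigma> s) =
    mean_next_count M (Suc n) (mean_action M N \<pi> (Suc n)) s"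
proof -
  have "measure_pmf.expectation (config_law M N \<pi> (Suc n)) (\<lambda>\<sigma>. state_count N \<sigma> s) =
      measure_pmf.expectation (config_law M N \<pi> n)
        (\<lambda>\<sigma>. mean_next_count M (Suc n) (\<pi> (Suc n) (state_count N \<sigma>)) s)"
    by (simp add: expectation_bind_pmf_finite finite_set_config_law finite_set_transition
        expectation_next_count[OF assms])
  also have "\<dots> = mean_next_count M (Suc n) (mean_action M N \<pi> (Suc n)) s"
    by (simp add: mean_next_count_def mean_action_def)
  finally show ?thesis .
qed

lemma sum_mean_action:
  fixes M :: "('s::finite) bandit"
  assumes "policy M N \<pi>" "t \<in> {1..horizon M}"
  shows "(\<Sum>a\<in>UNIV. mean_action M N \<pi> t s a) =
    measure_pmf.expectation (config_law M N \<pi> (t - 1)) (\<lambda>\<sigma>. state_count N \<sigma> s)"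
proof -
  have "(\<Sum>a\<in>UNIV. mean_action M N \<pi> t s a) =
      measure_pmf.expectation (config_law M N \<pi> (t - 1)) (\<lambda>\<sigma>. \<Sum>a\<in>UNIV. \<pi> t (state_count N \<sigma>) s a)"
    by (simp add: mean_action_def)
  then show ?thesis by (simp only: policy_state_count(2)[OF assms])
qed

text \<open>
  The constraints hold for the random counts, the flow constraint in conditional expectation, and
  they are linear, so they survive taking expectations. An empty horizon is excluded because the
  linear program constrains \<open>x\<^sub>1\<close> even then.
\<close>

lemma lp_feasible_mean_action:
  fixes M :: "('s::finite) bandit"
  assumes pol: "policy M N \<pi>" and N: "0 < N" and T: "1 \<le> horizon M"
  shows "lp_feasible M (\<lambda>t s a. mean_action M N \<pi> t s a / real N)"
  unfolding lp_feasible_def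
proof (intro conjI ballI allI)
  fix t s assume t: "t \<in> {2..horizon M}"
  then obtain m where m: "t = Suc (Suc m)"
    by (metis atLeastAtMost_iff Suc_le_D numeral_2_eq_2 Suc_le_mono)
  have "mean_next_count M (t - 1) (mean_action M N \<pi> (t - 1)) s = (\<Sum>a\<in>UNIV. mean_action M N \<pi> t s a)"
    using expectation_count_Suc[OF pol _ N, of m s] sum_mean_action[OF pol, of t s] t
    by (simp add: m del: config_law.simps)
  then show "(\<Sum>a\<in>UNIV. mean_action M N \<pi> t s a / real N) =
      (\<Sum>a\<in>UNIV. \<Sum>s'\<in>UNIV. mean_action M N \<pi> (t - 1) s' a / real N * pmf (kernel M (t - 1) s' a) s)"
    by (simp add: mean_next_count_def sum_divide_distrib[symmetric] del: One_nat_def)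
next
  fix t assume t: "t \<in> {1..horizon M}"
  have "(\<Sum>s\<in>UNIV. mean_action M N \<pi> t s True) =
      measure_pmf.expectation (config_law M N \<pi> (t - 1)) (\<lambda>\<sigma>. \<Sum>s\<in>UNIV. \<pi> t (state_count N \<sigma>) s True)"
    by (simp add: mean_action_def)
  also have "\<dots> = budget M t * real N"
    by (simp add: policy_state_count(3)[OF pol t])
  finally show "(\<Sum>s\<in>UNIV. mean_action M N \<pi> t s True / real N) = budget M t"
    using N by (simp add: sum_divide_distrib[symmetric])
next
  have *: "(\<Sum>a\<in>UNIV. mean_action M N \<pi> 1 s a) = (if s = init M then real N else 0)" for s
    using sum_mean_action[OF pol, of 1 s] T by (auto simp: state_count_def)
  show "(\<Sum>a\<in>UNIV. mean_action M N \<pi> 1 (init M) a / real N) = 1"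
    unfolding sum_divide_distrib[symmetric] * using N by simp
  show "(\<Sum>s\<in>UNIV. \<Sum>a\<in>UNIV. mean_action M N \<pi> 1 s a / real N) = 1"
    unfolding sum_divide_distrib[symmetric] * using N by simp
next
  fix t s a assume t: "t \<in> {1..horizon M}"
  have "0 \<le> \<pi> t (state_count N \<sigma>) s a" for \<sigma>
    using policy_state_count(1)[OF pol t, of \<sigma> s a] by (auto elim: Nats_cases)
  then show "0 \<le> mean_action M N \<pi> t s a / real N"
    by (simp add: mean_action_def)
qed

lemma policy_value_le_lp:
  fixes M :: "('s::finite) bandit"
  assumes pol: "policy M N \<pi>" and N: "0 < N" and opt: "optimal_occupation_measure M x"
  shows "policy_value M N \<pi> \<le> real N * lp_objective M x"
proof (cases "horizon M = 0")
  case True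
  then show ?thesis by (simp add: policy_value_eq_mean_action[OF pol] lp_objective_def)
next
  case False
  let ?y = "\<lambda>t s a. mean_action M N \<pi> t s a / real N"
  have "lp_feasible M ?y" using lp_feasible_mean_action[OF pol N] False by simp
  then have "lp_objective M ?y \<le> lp_objective M x"
    using opt unfolding optimal_occupation_measure_def is_arg_max_def by (auto simp: not_less)
  moreover have "lp_objective M (mean_action M N \<pi>) = real N * lp_objective M ?y"
    unfolding lp_objective_def sum_distrib_left using N by (intro sum.cong) simp_all
  ultimately show ?thesis using N by (simp add: policy_value_eq_mean_action[OF pol])
qed

section \<open>A diffusion regular policy tracks the occupation measure\<close>

lemma lp_feasible_flow:
  assumes "lp_feasible M x" "1 \<le> t" "Suc t \<le> horizon M"
  shows "(\<Sum>a\<in>UNIV. x (Suc t) s a) = mean_next_count M t (x t) s"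
proof -
  have "Suc t \<in> {2..horizon M}" using assms by auto
  with assms(1) have "(\<Sum>a\<in>UNIV. x (Suc t) s a) =
      (\<Sum>a\<in>UNIV. \<Sum>s'\<in>UNIV. x (Suc t - 1) s' a * pmf (kernel M (Suc t - 1) s' a) s)"
    unfolding lp_feasible_def by blast
  then show ?thesis by (simp only: mean_next_count_def diff_Suc_1)
qed

lemma lp_feasible_nonneg: "lp_feasible M x \<Longrightarrow> t \<in> {1..horizon M} \<Longrightarrow> 0 \<le> x t s a"
  unfolding lp_feasible_def by blast

lemma sum_lp_feasible:
  fixes M :: "('s::finite) bandit"
  assumes x: "lp_feasible M x" and t: "1 \<le> t" "t \<le> horizon M"
  shows "(\<Sum>s\<in>UNIV. \<Sum>a\<in>UNIV. x t s a) = 1"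
  using t
proof (induction t rule: dec_induct)
  case base
  show ?case using x unfolding lp_feasible_def by blast
next
  case (step n)
  have "(\<Sum>s\<in>UNIV. \<Sum>a\<in>UNIV. x (Suc n) s a) = (\<Sum>s\<in>UNIV. mean_next_count M n (x n) s)"
    using step by (intro sum.cong refl lp_feasible_flow[OF x]) auto
  then show ?case using step by (simp add: sum_mean_next_count)
qed

text \<open>
  The \<open>L\<^sup>1\<close> norms of \<open>Z\<^sub>t - N z\<^sub>t\<close> and \<open>X\<^sub>t - N x\<^sub>t\<close>, left unscaled so that no division by \<open>\<surd>N\<close> occurs in
  the induction over time.
\<close>

definition count_deviation :: "(nat \<Rightarrow> 's \<Rightarrow> bool \<Rightarrow> real) \<Rightarrow> nat \<Rightarrow> nat \<Rightarrow> (nat \<Rightarrow> 's::finite) \<Rightarrow> real" where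
  "count_deviation x N t \<sigma> = (\<Sum>s\<in>UNIV. \<bar>state_count N \<sigma> s - real N * (\<Sum>a\<in>UNIV. x t s a)\<bar>)"

definition action_deviation ::
    "(nat \<Rightarrow> 's \<Rightarrow> bool \<Rightarrow> real) \<Rightarrow> nat \<Rightarrow> 's rule \<Rightarrow> nat \<Rightarrow> (nat \<Rightarrow> 's::finite) \<Rightarrow> real" where
  "action_deviation x N \<pi> t \<sigma> = (\<Sum>s\<in>UNIV. \<Sum>a\<in>UNIV. \<bar>\<pi> t (state_count N \<sigma>) s a - real N * x t s a\<bar>)"

text \<open>
  The Lipschitz bound compares the actual diffusion statistic \<open>\<theta>\<close> with \<open>0\<close>, the statistic of the
  deterministic trajectory \<open>N z\<^sub>t\<close>, where the second regularity condition applies. Comparing with \<open>0\<close>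
  is legitimate because \<open>N z\<^sub>t\<close> is itself a nonnegative vector of total mass \<open>N\<close>.
\<close>

lemma action_deviation_le:
  fixes M :: "('s::finite) bandit"
  assumes reg: "diffusion_regular M x \<pi>" and x: "lp_feasible M x"
  obtains C1 C2 where "C1 > 0" "C2 > 0"
    "\<And>t N \<sigma>. t \<in> {1..horizon M} \<Longrightarrow> N \<in> sizes M \<Longrightarrow>
      action_deviation x N (\<pi> N) t \<sigma> \<le> C1 * count_deviation x N t \<sigma> + C2 * sqrt (real N)"
proof -
  obtain C1 where C1: "C1 > 0" "\<forall>t\<in>{1..horizon M}. \<forall>N\<in>sizes M.
      \<forall>\<theta>1\<in>diffusion_domain x N t. \<forall>\<theta>2\<in>diffusion_domain x N t.
      (\<Sum>s\<in>UNIV. \<Sum>a\<in>UNIV. \<bar>diffusion_map x \<pi> N t \<theta>1 s a - diffusion_map x \<pi> N t \<theta>2 s a\<bar>)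
        \<le> C1 * (\<Sum>s\<in>UNIV. \<bar>\<theta>1 s - \<theta>2 s\<bar>)"
    using reg[unfolded diffusion_regular_def, THEN conjunct1] by (elim exE conjE) (rule that)
  obtain C2 where C2: "C2 > 0" "\<forall>t\<in>{1..horizon M}. \<forall>N\<in>sizes M.
      (\<Sum>s\<in>UNIV. \<Sum>a\<in>UNIV. \<bar>diffusion_map x \<pi> N t (\<lambda>_. 0) s a\<bar>) \<le> C2"
    using reg[unfolded diffusion_regular_def, THEN conjunct2, THEN conjunct1] by (elim exE conjE) (rule that)
  show ?thesis
  proof (rule that[OF C1(1) C2(1)])
    fix t N \<sigma>
    assume t: "t \<in> {1..horizon M}" and N: "N \<in> sizes M"
    define r where "r = sqrt (real N)"
    have r: "r > 0" using N by (simp add: sizes_def r_def)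
    let ?z = "\<lambda>s. \<Sum>a\<in>UNIV. x t s a"
    define \<theta> where "\<theta> s = (state_count N \<sigma> s - real N * ?z s) / r" for s
    have scale: "r * \<theta> s = state_count N \<sigma> s - real N * ?z s" for s
      using r by (simp add: \<theta>_def)
    have un: "unscale x N t \<theta> = state_count N \<sigma>"
    proof
      show "unscale x N t \<theta> s = state_count N \<sigma> s" for s
        unfolding unscale_def r_def[symmetric] scale by simp
    qed
    have dom: "\<theta> \<in> diffusion_domain x N t"
      unfolding diffusion_domain_def mem_Collect_eq un
      using sum_state_count[of N \<sigma>] state_count_nonneg[of N \<sigma>] by blast
    have un0: "unscale x N t (\<lambda>_. 0) s = real N * ?z s" for s
      by (simp add: unscale_def)
    have "(\<Sum>s\<in>UNIV. ?z s) = 1"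
      using t sum_lp_feasible[OF x, of t] by simp
    then have "(\<Sum>s\<in>UNIV. real N * ?z s) = real N"
      by (simp only: sum_distrib_left[of "real N" ?z, symmetric] mult_1_right)
    moreover have "0 \<le> real N * ?z s" for s
      by (intro mult_nonneg_nonneg sum_nonneg lp_feasible_nonneg[OF x t]) simp
    ultimately have dom0: "(\<lambda>_. 0) \<in> diffusion_domain x N t"
      unfolding diffusion_domain_def mem_Collect_eq un0 by blast
    let ?D = "\<lambda>s a. diffusion_map x \<pi> N t \<theta> s a"
    let ?E = "\<lambda>s a. diffusion_map x \<pi> N t (\<lambda>_. 0) s a"
    have "r * \<bar>?D s a\<bar> = \<bar>\<pi> N t (state_count N \<sigma>) s a - real N * x t s a\<bar>" for s a
      unfolding diffusion_map_def un r_def[symmetric] using r by (simp add: abs_divide)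
    then have "action_deviation x N (\<pi> N) t \<sigma> = r * (\<Sum>s\<in>UNIV. \<Sum>a\<in>UNIV. \<bar>?D s a\<bar>)"
      by (simp only: action_deviation_def sum_distrib_left[of r])
    also have "\<dots> \<le> r * (C1 * (\<Sum>s\<in>UNIV. \<bar>\<theta> s\<bar>) + C2)"
    proof (rule mult_left_mono)
      have "(\<Sum>s\<in>UNIV. \<Sum>a\<in>UNIV. \<bar>?D s a\<bar>) \<le>
          (\<Sum>s\<in>UNIV. \<Sum>a\<in>UNIV. \<bar>?D s a - ?E s a\<bar>) + (\<Sum>s\<in>UNIV. \<Sum>a\<in>UNIV. \<bar>?E s a\<bar>)"
        unfolding sum.distrib[symmetric] by (intro sum_mono) linarith
      also have "\<dots> \<le> C1 * (\<Sum>s\<in>UNIV. \<bar>\<theta> s - 0\<bar>) + C2"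
        by (rule add_mono[OF C1(2)[rule_format, OF t N dom dom0] C2(2)[rule_format, OF t N]])
      finally show "(\<Sum>s\<in>UNIV. \<Sum>a\<in>UNIV. \<bar>?D s a\<bar>) \<le> C1 * (\<Sum>s\<in>UNIV. \<bar>\<theta> s\<bar>) + C2"
        by (simp only: diff_zero)
    qed (use r in simp)
    also have "\<dots> = C1 * (r * (\<Sum>s\<in>UNIV. \<bar>\<theta> s\<bar>)) + C2 * r"
      by (simp only: distrib_left mult.left_commute mult.commute)
    also have "r * (\<Sum>s\<in>UNIV. \<bar>\<theta> s\<bar>) = count_deviation x N t \<sigma>"
    proof -
      have "r * \<bar>\<theta> s\<bar> = \<bar>state_count N \<sigma> s - real N * ?z s\<bar>" for s
        unfolding scale[symmetric] abs_mult using r by simp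
      then show ?thesis
        by (simp only: count_deviation_def sum_distrib_left[of r])
    qed
    finally show "action_deviation x N (\<pi> N) t \<sigma> \<le> C1 * count_deviation x N t \<sigma> + C2 * sqrt (real N)"
      by (simp only: r_def)
  qed
qed

text \<open>
  The deviation at the next time splits into the random fluctuation around the conditional mean, at
  most \<open>\<surd>N\<close> per state, and the distance of this mean from \<open>N z\<^sub>t\<^sub>+\<^sub>1\<close>. Their difference is the
  image of \<open>X\<^sub>t - N x\<^sub>t\<close> under the linear map \<open>mean_next_count\<close>, which cannot increase the
  \<open>L\<^sup>1\<close> norm because every transition kernel has total mass \<open>1\<close>.
\<close>

lemma count_deviation_Suc:
  fixes M :: "('s::finite) bandit"
  assumes pol: "policy M N \<pi>" and N: "0 < N" and x: "lp_feasible M x"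
    and t: "1 \<le> t" "Suc t \<le> horizon M"
  shows "measure_pmf.expectation (transition M N \<pi> t \<sigma>) (count_deviation x N (Suc t)) \<le>
    real CARD('s) * sqrt (real N) + action_deviation x N \<pi> t \<sigma>"
proof -
  let ?P = "transition M N \<pi> t \<sigma>"
  let ?X = "\<pi> t (state_count N \<sigma>)"
  let ?Y = "\<lambda>s a. real N * x t s a"
  have [simp]: "integrable ?P f" for f :: "_ \<Rightarrow> real"
    by (rule integrable_measure_pmf_finite[OF finite_set_transition])
  have t': "t \<in> {1..horizon M}" using t by auto
  have flow: "real N * (\<Sum>a\<in>UNIV. x (Suc t) s a) = mean_next_count M t ?Y s" for s
    unfolding lp_feasible_flow[OF x t] by (simp add: mean_next_count_def sum_distrib_left mult.assoc)
  have "count_deviation x N (Suc t) \<sigma>' \<le>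
      (\<Sum>s\<in>UNIV. \<bar>state_count N \<sigma>' s - mean_next_count M t ?X s\<bar>) + action_deviation x N \<pi> t \<sigma>" for \<sigma>'
  proof -
    have "count_deviation x N (Suc t) \<sigma>' \<le> (\<Sum>s\<in>UNIV. \<bar>state_count N \<sigma>' s - mean_next_count M t ?X s\<bar> +
        \<bar>mean_next_count M t ?X s - mean_next_count M t ?Y s\<bar>)"
      unfolding count_deviation_def flow by (intro sum_mono) simp
    also have "\<dots> \<le> (\<Sum>s\<in>UNIV. \<bar>state_count N \<sigma>' s - mean_next_count M t ?X s\<bar>) +
        action_deviation x N \<pi> t \<sigma>"
      unfolding action_deviation_def sum_mean_next_count[of M t, symmetric] sum.distrib
      by (intro add_left_mono sum_mono abs_mean_next_count_diff_le)
    finally show ?thesis .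
  qed
  then have "measure_pmf.expectation ?P (count_deviation x N (Suc t)) \<le>
      measure_pmf.expectation ?P (\<lambda>\<sigma>'. (\<Sum>s\<in>UNIV. \<bar>state_count N \<sigma>' s - mean_next_count M t ?X s\<bar>) +
        action_deviation x N \<pi> t \<sigma>)"
    by (intro integral_mono) auto
  also have "\<dots> = (\<Sum>s\<in>UNIV. measure_pmf.expectation ?P
      (\<lambda>\<sigma>'. \<bar>state_count N \<sigma>' s - mean_next_count M t ?X s\<bar>)) + action_deviation x N \<pi> t \<sigma>"
    by simp
  also have "\<dots> \<le> (\<Sum>s\<in>(UNIV :: 's set). sqrt (real N)) + action_deviation x N \<pi> t \<sigma>"
    by (intro add_right_mono sum_mono next_count_deviation[OF pol t' N])
  finally show ?thesis by simp
qed

text \<open>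
  Both \<open>z\<^sub>1\<close> and the initial configuration concentrate all mass on the initial state.
\<close>

lemma count_deviation_initial:
  fixes M :: "('s::finite) bandit"
  assumes x: "lp_feasible M x" and T: "1 \<le> horizon M"
  shows "count_deviation x N 1 (\<lambda>i. init M) = 0"
proof -
  let ?z = "\<lambda>s. \<Sum>a\<in>UNIV. x 1 s a"
  have nn: "0 \<le> ?z s" for s using lp_feasible_nonneg[OF x] T by (simp add: sum_nonneg)
  have z1: "?z (init M) = 1" and "(\<Sum>s\<in>UNIV. ?z s) = 1"
    using x unfolding lp_feasible_def by auto
  then have "(\<Sum>s\<in>UNIV - {init M}. ?z s) = 0"
    by (subst sum_diff1) auto
  then have "?z s = 0" if "s \<noteq> init M" for s
    using that nn by (subst (asm) sum_nonneg_eq_0_iff) auto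
  then have "state_count N (\<lambda>i. init M) s - real N * ?z s = 0" for s
    using z1 by (cases "s = init M") (auto simp: state_count_def)
  then show ?thesis by (simp add: count_deviation_def)
qed

text \<open>
  Discrete Gronwall argument: the bounds \<open>K\<^sub>t \<surd>N\<close> satisfy \<open>K\<^sub>t\<^sub>+\<^sub>1 = |S| + C\<^sub>1 K\<^sub>t + C\<^sub>2\<close>. The constant
  may depend on the time, but it must be chosen before the number of arms.
\<close>

lemma expectation_count_deviation_le:
  fixes M :: "('s::finite) bandit"
  assumes pol: "\<And>N. N \<in> sizes M \<Longrightarrow> policy M N (\<pi> N)"
    and x: "lp_feasible M x"
    and nn: "0 \<le> C1"
    and act: "\<And>t N \<sigma>. t \<in> {1..horizon M} \<Longrightarrow> N \<in> sizes M \<Longrightarrow>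
      action_deviation x N (\<pi> N) t \<sigma> \<le> C1 * count_deviation x N t \<sigma> + C2 * sqrt (real N)"
    and n: "n < horizon M"
  shows "\<exists>K. \<forall>N\<in>sizes M. measure_pmf.expectation (config_law M N (\<pi> N) n) (count_deviation x N (Suc n))
    \<le> K * sqrt (real N)"
  using n
proof (induction n)
  case 0
  then have "count_deviation x N (Suc 0) (\<lambda>i. init M) = 0" for N
    using count_deviation_initial[OF x, of N] by simp
  then show ?case by (intro exI[of _ 0]) simp
next
  case (Suc n)
  then obtain K where K: "\<And>N. N \<in> sizes M \<Longrightarrow>
      measure_pmf.expectation (config_law M N (\<pi> N) n) (count_deviation x N (Suc n)) \<le> K * sqrt (real N)"
    by auto
  have "measure_pmf.expectation (config_law M N (\<pi> N) (Suc n)) (count_deviation x N (Suc (Suc n)))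
      \<le> (real CARD('s) + C1 * K + C2) * sqrt (real N)" if N: "N \<in> sizes M" for N
  proof -
    let ?L = "config_law M N (\<pi> N) n"
    have N0: "0 < N" using N by (simp add: sizes_def)
    have "measure_pmf.expectation (config_law M N (\<pi> N) (Suc n)) (count_deviation x N (Suc (Suc n))) =
        measure_pmf.expectation ?L (\<lambda>\<sigma>. measure_pmf.expectation (transition M N (\<pi> N) (Suc n) \<sigma>)
          (count_deviation x N (Suc (Suc n))))"
      by (simp add: expectation_bind_pmf_finite finite_set_config_law finite_set_transition)
    also have "\<dots> \<le> measure_pmf.expectation ?L (\<lambda>\<sigma>. real CARD('s) * sqrt (real N) +
        (C1 * count_deviation x N (Suc n) \<sigma> + C2 * sqrt (real N)))"
      using Suc.prems by (intro integral_mono order_trans[OF count_deviation_Suc[OF pol[OF N] N0 x]]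
          add_left_mono act N) auto
    also have "\<dots> = real CARD('s) * sqrt (real N) +
        (C1 * measure_pmf.expectation ?L (count_deviation x N (Suc n)) + C2 * sqrt (real N))"
      by simp
    also have "\<dots> \<le> real CARD('s) * sqrt (real N) + (C1 * (K * sqrt (real N)) + C2 * sqrt (real N))"
      using nn K[OF N] by (intro add_left_mono add_right_mono mult_left_mono)
    finally show ?thesis by (simp add: algebra_simps)
  qed
  then show ?case by blast
qed

lemma mean_action_deviation_le:
  fixes M :: "('s::finite) bandit"
  assumes pol: "\<And>N. N \<in> sizes M \<Longrightarrow> policy M N (\<pi> N)"
    and x: "lp_feasible M x" and reg: "diffusion_regular M x \<pi>"
    and t: "t \<in> {1..horizon M}"
  shows "\<exists>K. \<forall>N\<in>sizes M. \<forall>s a. \<bar>mean_action M N (\<pi> N) t s a - real N * x t s a\<bar> \<le> K * sqrt (real N)"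
proof -
  obtain C1 C2 where C: "C1 > 0" "\<And>t N \<sigma>. t \<in> {1..horizon M} \<Longrightarrow> N \<in> sizes M \<Longrightarrow>
      action_deviation x N (\<pi> N) t \<sigma> \<le> C1 * count_deviation x N t \<sigma> + C2 * sqrt (real N)"
    using action_deviation_le[OF reg x] by metis
  have t1: "Suc (t - 1) = t" "t - 1 < horizon M" using t by auto
  obtain K where K: "\<And>N. N \<in> sizes M \<Longrightarrow>
      measure_pmf.expectation (config_law M N (\<pi> N) (t - 1)) (count_deviation x N t) \<le> K * sqrt (real N)"
    using expectation_count_deviation_le[OF pol x _ C(2) t1(2)] C(1) unfolding t1(1) by auto
  have "\<bar>mean_action M N (\<pi> N) t s a - real N * x t s a\<bar> \<le> (C1 * K + C2) * sqrt (real N)"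
    if N: "N \<in> sizes M" for N s a
  proof -
    let ?L = "config_law M N (\<pi> N) (t - 1)"
    have single: "\<bar>\<pi> N t (state_count N \<sigma>) s a - real N * x t s a\<bar> \<le> action_deviation x N (\<pi> N) t \<sigma>" for \<sigma>
    proof -
      let ?d = "\<lambda>s a. \<bar>\<pi> N t (state_count N \<sigma>) s a - real N * x t s a\<bar>"
      have "?d s a \<le> (\<Sum>a\<in>UNIV. ?d s a)" by (rule member_le_sum) auto
      also have "\<dots> \<le> (\<Sum>s\<in>UNIV. \<Sum>a\<in>UNIV. ?d s a)"
        by (rule member_le_sum[of s UNIV "\<lambda>s. \<Sum>a\<in>UNIV. ?d s a"]) (auto intro: sum_nonneg)
      finally show ?thesis by (simp add: action_deviation_def)
    qed
    have "\<bar>mean_action M N (\<pi> N) t s a - real N * x t s a\<bar> =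
        \<bar>measure_pmf.expectation ?L (\<lambda>\<sigma>. \<pi> N t (state_count N \<sigma>) s a - real N * x t s a)\<bar>"
      by (simp add: mean_action_def)
    also have "\<dots> \<le> measure_pmf.expectation ?L (\<lambda>\<sigma>. \<bar>\<pi> N t (state_count N \<sigma>) s a - real N * x t s a\<bar>)"
      by (rule integral_abs_bound)
    also have "\<dots> \<le> measure_pmf.expectation ?L (\<lambda>\<sigma>. C1 * count_deviation x N t \<sigma> + C2 * sqrt (real N))"
      by (intro integral_mono order_trans[OF single] C(2) t N) auto
    also have "\<dots> = C1 * measure_pmf.expectation ?L (count_deviation x N t) + C2 * sqrt (real N)"
      by simp
    also have "\<dots> \<le> C1 * (K * sqrt (real N)) + C2 * sqrt (real N)"
      using C(1) K[OF N] by (intro add_right_mono mult_left_mono) auto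
    finally show ?thesis by (simp add: algebra_simps)
  qed
  then show ?thesis by blast
qed

lemma policy_value_ge_lp:
  fixes M :: "('s::finite) bandit"
  assumes pol: "\<And>N. N \<in> sizes M \<Longrightarrow> policy M N (\<pi> N)"
    and x: "lp_feasible M x" and reg: "diffusion_regular M x \<pi>"
  obtains C where "\<And>N. N \<in> sizes M \<Longrightarrow>
    real N * lp_objective M x - C * sqrt (real N) \<le> policy_value M N (\<pi> N)"
proof -
  have "\<forall>t\<in>{1..horizon M}. \<exists>K. \<forall>N\<in>sizes M. \<forall>s a.
      \<bar>mean_action M N (\<pi> N) t s a - real N * x t s a\<bar> \<le> K * sqrt (real N)"
    using mean_action_deviation_le[OF pol x reg] by blast
  then obtain K where K: "\<forall>t\<in>{1..horizon M}. \<forall>N\<in>sizes M. \<forall>s a.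
      \<bar>mean_action M N (\<pi> N) t s a - real N * x t s a\<bar> \<le> K t * sqrt (real N)"
    by (rule bchoice[THEN exE])
  define C where "C = (\<Sum>t=1..horizon M. \<Sum>s\<in>UNIV. \<Sum>a\<in>UNIV. \<bar>reward M t s a\<bar> * K t)"
  show ?thesis
  proof (rule that[of C])
    fix N assume N: "N \<in> sizes M"
    have loss: "reward M t s a * (real N * x t s a - mean_action M N (\<pi> N) t s a) \<le> \<bar>reward M t s a\<bar> * K t * sqrt (real N)"
      if "t \<in> {1..horizon M}" for t s a
    proof -
      have "reward M t s a * (real N * x t s a - mean_action M N (\<pi> N) t s a) \<le>
          \<bar>reward M t s a\<bar> * \<bar>mean_action M N (\<pi> N) t s a - real N * x t s a\<bar>"
        by (metis abs_ge_self abs_minus_commute abs_mult)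
      also have "\<dots> \<le> \<bar>reward M t s a\<bar> * (K t * sqrt (real N))"
        using K[rule_format, OF that N] by (intro mult_left_mono) auto
      finally show ?thesis by (simp add: mult.assoc)
    qed
    have "real N * lp_objective M x - policy_value M N (\<pi> N) =
        (\<Sum>t=1..horizon M. \<Sum>s\<in>UNIV. \<Sum>a\<in>UNIV.
          reward M t s a * (real N * x t s a - mean_action M N (\<pi> N) t s a))"
      unfolding policy_value_eq_mean_action[OF pol[OF N]] lp_objective_def
      by (simp add: sum_distrib_left sum_subtractf[symmetric] algebra_simps)
    also have "\<dots> \<le> (\<Sum>t=1..horizon M. \<Sum>s\<in>UNIV. \<Sum>a\<in>UNIV. \<bar>reward M t s a\<bar> * K t * sqrt (real N))"
      by (intro sum_mono loss) auto
    also have "\<dots> = C * sqrt (real N)" by (simp add: C_def sum_distrib_right)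
    finally show "real N * lp_objective M x - C * sqrt (real N) \<le> policy_value M N (\<pi> N)" by simp
  qed
qed

section \<open>The optimality gap\<close>

theorem theorem2:
  fixes M :: "('s::finite) bandit"
    and x :: "nat \<Rightarrow> 's \<Rightarrow> bool \<Rightarrow> real"
    and \<pi> :: "nat \<Rightarrow> 's rule"
  assumes "bandit M"
    and "optimal_occupation_measure M x"
    and "\<And>N. N \<in> sizes M \<Longrightarrow> policy M N (\<pi> N)"
    and "diffusion_regular M x \<pi>"
  shows "(\<lambda>N. optimal_value M N - policy_value M N (\<pi> N)) \<in> O[large_sizes M](\<lambda>N. sqrt (real N))"
proof -
  have x: "lp_feasible M x"
    using assms(2) by (simp add: optimal_occupation_measure_def is_arg_max_def)
  obtain C where C: "\<And>N. N \<in> sizes M \<Longrightarrow>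
      real N * lp_objective M x - C * sqrt (real N) \<le> policy_value M N (\<pi> N)"
    using policy_value_ge_lp[OF assms(3) x assms(4)] by blast
  have "norm (optimal_value M N - policy_value M N (\<pi> N)) \<le> C * norm (sqrt (real N))"
    if N: "N \<in> sizes M" for N
  proof -
    let ?V = "policy_value M N ` {\<pi>. policy M N \<pi>}"
    have upper: "v \<le> real N * lp_objective M x" if "v \<in> ?V" for v
      using that N policy_value_le_lp[OF _ _ assms(2)] by (auto simp: sizes_def)
    have mem: "policy_value M N (\<pi> N) \<in> ?V" using assms(3)[OF N] by auto
    have "policy_value M N (\<pi> N) \<le> optimal_value M N"
      unfolding optimal_value_def using upper mem by (intro cSup_upper) (auto simp: bdd_above_def)
    moreover have "optimal_value M N \<le> real N * lp_objective M x"
      unfolding optimal_value_def using upper mem by (intro cSup_least) auto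
    ultimately show ?thesis using C[OF N] by simp
  qed
  then show ?thesis
    by (intro bigoI[where c = C]) (auto simp: large_sizes_def eventually_inf_principal)
qed

end
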